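(* Let $f:\mathbb{R}^{n\times m}\to\mathbb{R}$ be a smooth convex function, let $\lambda>0$, and let $1\le p\le\min\{n,m\}$. Let $(U,B,V)$ be a local minimum of the fixed-rank problem $$\min_{U,B,V}\; f(UBV^T)+\lambda\,\mathrm{Trace}(B)\quad\text{subject to } U\in \mathrm{St}(p,n),\; B\in S_{++}(p),\; V\in \mathrm{St}(p,m),$$ and set $X=UBV^T$ and $S=\mathrm{Grad}_X f(UBV^T)$. Then $X$ is a global optimum of the convex problem $$\min_{X\in\mathbb{R}^{n\times m}}\; f(X)+\lambda\|X\|_*$$ if and only if $\|S\|_{op}=\lambda$. Moreover, $\|S\|_{op}\ge\lambda$, and equality holds only at optimality (i.e. only if $X$ is a global optimum of the convex problem).
   Context: $\mathrm{St}(p,n)=\{U\in\mathbb{R}^{n\times p}: U^TU=I_p\}$ is the Stiefel manifold of $n\times p$ matrices with orthonormal columns. $S_{++}(p)$ is the cone of $p\times p$ symmetric positive definite real matrices. $\|X\|_*$ is the trace norm (nuclear norm), the sum of the singular values of $X$. $\|S\|_{op}$ is the operator norm, i.e. the largest singular value of $S$. $\mathrm{Grad}_X f(X)\in\mathbb{R}^{n\times m}$ is the Euclidean gradient of $f$ at $X$ (with respect to $\langle A,C\rangle=\mathrm{Trace}(A^TC)$), and $\mathrm{Grad}_X f(UBV^T)$ is this gradient evaluated at $X=UBV^T$. *)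

theory Defs
  imports "HOL-Analysis.Analysis"
begin

definition stiefel :: "(real^'p^'n) set" where
  "stiefel = {U. transpose U ** U = mat 1}"

definition spd_cone :: "(real^'p^'p) set" where
  "spd_cone = {B. transpose B = B \<and> (\<forall>v. v \<noteq> 0 \<longrightarrow> 0 < v \<bullet> (B *v v))}"

text \<open>
  Singular values are the square roots of the eigenvalues of \<open>A\<^sup>T A\<close>. The multiplicity of a
  singular value is the dimension of the eigenspace, which for the symmetric matrix \<open>A\<^sup>T A\<close> is also
  the algebraic multiplicity. If \<open>A\<close> has more columns than rows, this may count additional
  zero singular values compared with the convention of exactly \<open>min n m\<close> singular values.
\<close>

definition sv_space :: "real^'m^'n \<Rightarrow> real \<Rightarrow> (real^'m) set" where
  "sv_space A \<sigma> = {v. (transpose A ** A) *v v = \<sigma>\<^sup>2 *\<^sub>R v}"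

definition singular_values :: "real^'m^'n \<Rightarrow> real set" where
  "singular_values A = {\<sigma>. 0 \<le> \<sigma> \<and> (\<exists>v. v \<noteq> 0 \<and> v \<in> sv_space A \<sigma>)}"

definition trace_norm :: "real^'m^'n \<Rightarrow> real" where
  "trace_norm A = (\<Sum>\<sigma>\<in>singular_values A. real (dim (sv_space A \<sigma>)) * \<sigma>)"

lemma gram_inner: "((transpose A ** A) *v v) \<bullet> w = (A *v v) \<bullet> (A *v w)"
  for A :: "real^'m^'n"
  by (metis dot_lmul_matrix matrix_vector_mul_assoc transpose_matrix_vector transpose_transpose)

text \<open>The sum in \<open>trace_norm\<close> ranges over a finite set.\<close>

lemma finite_singular_values: "finite (singular_values A)"
  for A :: "real^'m^'n"
proof -
  define v where "v \<sigma> = (SOME v. v \<noteq> 0 \<and> v \<in> sv_space A \<sigma>)" for \<sigma>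
  have v: "v \<sigma> \<noteq> 0" "(transpose A ** A) *v v \<sigma> = \<sigma>\<^sup>2 *\<^sub>R v \<sigma>"
    if "\<sigma> \<in> singular_values A" for \<sigma>
    using someI_ex[of "\<lambda>v. v \<noteq> 0 \<and> v \<in> sv_space A \<sigma>"] that
    by (auto simp: v_def singular_values_def sv_space_def)
  have orth: "v \<sigma> \<bullet> v \<tau> = 0"
    if "\<sigma> \<in> singular_values A" "\<tau> \<in> singular_values A" "\<sigma> \<noteq> \<tau>" for \<sigma> \<tau>
  proof -
    have "\<sigma>\<^sup>2 * (v \<sigma> \<bullet> v \<tau>) = \<tau>\<^sup>2 * (v \<sigma> \<bullet> v \<tau>)"
      using gram_inner[of A "v \<sigma>" "v \<tau>"] gram_inner[of A "v \<tau>" "v \<sigma>"] v that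
      by (simp add: inner_commute)
    moreover have "\<sigma>\<^sup>2 \<noteq> \<tau>\<^sup>2"
      using that by (auto simp: singular_values_def)
    ultimately show ?thesis by simp
  qed
  have "inj_on v (singular_values A)"
    using orth v by (metis inj_onI inner_eq_zero_iff)
  moreover have "finite (v ` singular_values A)"
  proof (rule pairwise_orthogonal_imp_finite)
    show "pairwise orthogonal (v ` singular_values A)"
      using orth by (auto simp: pairwise_def orthogonal_def)
  qed
  ultimately show ?thesis by (metis finite_imageD)
qed

text \<open>The operator norm used in the statement is \<open>onorm\<close>; it is the largest singular value.\<close>

lemma onorm_eq_Max_singular_values: "onorm ((*v) A) = Max (singular_values A)"
  for A :: "real^'m^'n"
proof (rule sym, rule Max_eqI)
  show "finite (singular_values A)" by (rule finite_singular_values)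
next
  fix \<sigma> assume "\<sigma> \<in> singular_values A"
  then obtain v where \<sigma>: "0 \<le> \<sigma>" and v: "v \<noteq> 0" "(transpose A ** A) *v v = \<sigma>\<^sup>2 *\<^sub>R v"
    by (auto simp: singular_values_def sv_space_def)
  have "(norm (A *v v))\<^sup>2 = (\<sigma> * norm v)\<^sup>2"
    using gram_inner[of A v v] v by (simp add: power2_norm_eq_inner power_mult_distrib)
  then have "norm (A *v v) = \<sigma> * norm v"
    using \<sigma> by (simp add: power2_eq_iff_nonneg)
  then have "\<sigma> * norm v \<le> onorm ((*v) A) * norm v"
    using onorm[of "(*v) A" v] matrix_vector_mul_bounded_linear by metis
  then show "\<sigma> \<le> onorm ((*v) A)" using v by simp
next
  let ?s = "onorm ((*v) A)"
  have s0: "0 \<le> ?s" by (simp add: onorm_pos_le matrix_vector_mul_bounded_linear)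
  have bd: "norm (A *v x) \<le> ?s * norm x" for x
    using onorm matrix_vector_mul_bounded_linear by metis
  have ne: "sphere (0::real^'m) 1 \<noteq> {}"
    by simp
  have "\<exists>x\<in>sphere (0::real^'m) 1. \<forall>y\<in>sphere 0 1. norm (A *v y) \<le> norm (A *v x)"
    by (rule continuous_attains_sup[OF compact_sphere ne])
       (intro continuous_intros linear_continuous_on matrix_vector_mul_bounded_linear)
  then obtain x where x: "norm x = 1" and mx: "\<And>y. norm y = 1 \<Longrightarrow> norm (A *v y) \<le> norm (A *v x)"
    by auto
  have "norm (A *v y) \<le> norm (A *v x) * norm y" for y
  proof (cases "y = 0")
    case False
    then have "norm (A *v ((1 / norm y) *\<^sub>R y)) \<le> norm (A *v x)" by (intro mx) simp
    then show ?thesis using False by (simp add: matrix_vector_mult_scaleR field_simps)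
  qed simp
  then have "?s \<le> norm (A *v x)" by (intro onorm_le)
  then have sx: "norm (A *v x) = ?s" using bd[of x] x by simp
  define w where "w = (transpose A ** A) *v x"
  have wx: "w \<bullet> x = ?s\<^sup>2"
    using gram_inner[of A x x] sx by (simp add: w_def power2_norm_eq_inner[symmetric])
  have "norm w ^ 2 = (A *v x) \<bullet> (A *v w)"
    using gram_inner[of A x w] by (simp add: w_def power2_norm_eq_inner)
  also have "\<dots> \<le> ?s * (?s * norm w)"
    using norm_cauchy_schwarz[of "A *v x" "A *v w"] mult_left_mono[OF bd[of w] s0] sx by simp
  finally have "norm w * norm w \<le> ?s\<^sup>2 * norm w" by (simp add: power2_eq_square mult.assoc)
  then have "norm w \<le> ?s\<^sup>2" by (cases "norm w = 0") (auto simp: mult_le_cancel_right)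
  then have "w \<bullet> w \<le> ?s\<^sup>2 * ?s\<^sup>2"
    using mult_mono[of "norm w" "?s\<^sup>2" "norm w" "?s\<^sup>2"]
    by (simp add: power2_norm_eq_inner[symmetric] power2_eq_square[of "norm w"])
  then have "(w - ?s\<^sup>2 *\<^sub>R x) \<bullet> (w - ?s\<^sup>2 *\<^sub>R x) \<le> 0"
    using wx x norm_eq_1[of x] by (simp add: inner_diff_left inner_diff_right inner_commute)
  then have "w = ?s\<^sup>2 *\<^sub>R x" by (metis inner_ge_zero inner_eq_zero_iff order_antisym right_minus_eq)
  then show "?s \<in> singular_values A"
    using s0 x by (auto simp: singular_values_def sv_space_def w_def intro!: exI[of _ x])
qed

text \<open>
  On a finite-dimensional domain, a map is \<open>C\<^sup>k\<^sup>+\<^sup>1\<close> iff it is differentiable everywhere and its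
  derivative in each fixed direction is \<open>C\<^sup>k\<close>.
\<close>

fun C_k :: "nat \<Rightarrow> ('a::euclidean_space \<Rightarrow> 'b::real_normed_vector) \<Rightarrow> bool" where
  "C_k 0 f \<longleftrightarrow> continuous_on UNIV f"
| "C_k (Suc k) f \<longleftrightarrow>
     (\<forall>x. f differentiable (at x)) \<and> (\<forall>v. C_k k (\<lambda>x. frechet_derivative f (at x) v))"

definition smooth :: "('a::euclidean_space \<Rightarrow> 'b::real_normed_vector) \<Rightarrow> bool" where
  "smooth f \<longleftrightarrow> (\<forall>k. C_k k f)"

definition is_gradient :: "(real^'m^'n \<Rightarrow> real) \<Rightarrow> real^'m^'n \<Rightarrow> real^'m^'n \<Rightarrow> bool" where
  "is_gradient f X S \<longleftrightarrow> (f has_derivative (\<lambda>H. trace (transpose S ** H))) (at X)"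

definition is_local_min :: "('a::metric_space \<Rightarrow> real) \<Rightarrow> 'a set \<Rightarrow> 'a \<Rightarrow> bool" where
  "is_local_min g C z \<longleftrightarrow>
     z \<in> C \<and> (\<exists>\<epsilon>>0. \<forall>w\<in>C. dist w z < \<epsilon> \<longrightarrow> g z \<le> g w)"

definition is_global_min :: "('a \<Rightarrow> real) \<Rightarrow> 'a \<Rightarrow> bool" where
  "is_global_min g x \<longleftrightarrow> (\<forall>y. g x \<le> g y)"

end

theory Submission
  imports Defs
begin

text \<open>
  Local minimality is tested along one family of feasible points, the scalings \<open>(U, s B, V)\<close>
  with \<open>s > 0\<close>. Stationarity along it is the Euler-type identity \<open>\<langle>S, X\<rangle> = -\<lambda> Trace B\<close>. Everything else is the
  duality between the trace norm and the operator norm.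

  If \<open>X = U B V\<^sup>T\<close> with orthonormal \<open>U, V\<close> and positive definite \<open>B\<close>, then \<open>\<parallel>X\<parallel>\<^sub>* \<le> Trace B\<close>, so
  Hoelder's inequality \<open>\<bar>\<langle>S, X\<rangle>\<bar> \<le> \<parallel>S\<parallel>\<^sub>o\<^sub>p \<parallel>X\<parallel>\<^sub>*\<close> turns the identity into
  \<open>\<lambda> Trace B \<le> \<parallel>S\<parallel>\<^sub>o\<^sub>p Trace B\<close>, and \<open>Trace B > 0\<close> gives \<open>\<lambda> \<le> \<parallel>S\<parallel>\<^sub>o\<^sub>p\<close>.
  If \<open>\<parallel>S\<parallel>\<^sub>o\<^sub>p = \<lambda>\<close>, then for every \<open>Y\<close> the tangent inequality of the convex function \<open>f\<close> yields
  \<open>f Y - f X \<ge> \<langle>S, Y\<rangle> - \<langle>S, X\<rangle> \<ge> -\<lambda> \<parallel>Y\<parallel>\<^sub>* + \<lambda> Trace B \<ge> -\<lambda> \<parallel>Y\<parallel>\<^sub>* + \<lambda> \<parallel>X\<parallel>\<^sub>*\<close>,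
  which is global optimality. Conversely, the trace norm grows by at most \<open>t \<parallel>u\<parallel> \<parallel>v\<parallel>\<close> when
  \<open>t u v\<^sup>T\<close> is added to its argument. Hence at a global optimum the derivative of \<open>f\<close> in the direction
  \<open>u v\<^sup>T\<close> is at least \<open>-\<lambda> \<parallel>u\<parallel> \<parallel>v\<parallel>\<close>, and the choice \<open>u = - S v\<close> bounds \<open>\<parallel>S v\<parallel>\<close> by \<open>\<lambda> \<parallel>v\<parallel>\<close>.

  The duality comes from the spectral theorem for \<open>A\<^sup>T A\<close> (\<open>selfadjoint_orthonormal_eigenbasis\<close>).
  It provides an orthonormal basis \<open>E\<close> whose images under \<open>A\<close> are mutually orthogonal, and
  \<open>\<parallel>A\<parallel>\<^sub>* = (\<Sum>e\<in>E. \<parallel>A e\<parallel>)\<close> (\<open>trace_norm_eq_sum_eigenbasis\<close>).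
\<close>

section \<open>Orthonormal bases and the spectral theorem\<close>

definition orthonormal_basis :: "'a::euclidean_space set \<Rightarrow> bool" where
  "orthonormal_basis E \<longleftrightarrow> pairwise orthogonal E \<and> (\<forall>e\<in>E. norm e = 1) \<and> span E = UNIV"

lemma orthonormal_set_independent:
  fixes E :: "'a::euclidean_space set"
  assumes "pairwise orthogonal E" "\<And>e. e \<in> E \<Longrightarrow> norm e = 1"
  shows "independent E"
  using assms by (intro pairwise_orthogonal_independent) force+

lemma orthonormal_basis_finite: "orthonormal_basis E \<Longrightarrow> finite E"
  by (metis independent_imp_finite orthonormal_basis_def orthonormal_set_independent)

lemma orthonormal_basis_expansion:
  assumes "orthonormal_basis E"
  shows "(\<Sum>e\<in>E. (x \<bullet> e) *\<^sub>R e) = x"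
  using assms orthonormal_basis_finite[OF assms]
  by (intro orthonormal_basis_expand) (auto simp: orthonormal_basis_def)

lemma parseval:
  assumes "orthonormal_basis E"
  shows "x \<bullet> y = (\<Sum>e\<in>E. (x \<bullet> e) * (y \<bullet> e))"
proof -
  have "x \<bullet> y = (\<Sum>e\<in>E. (x \<bullet> e) *\<^sub>R e) \<bullet> y"
    by (simp add: orthonormal_basis_expansion[OF assms])
  also have "\<dots> = (\<Sum>e\<in>E. (x \<bullet> e) * (y \<bullet> e))"
    by (simp only: inner_sum_left inner_scaleR_left inner_commute[of y])
  finally show ?thesis .
qed

text \<open>
  A maximiser \<open>x\<close> of the Rayleigh quotient on \<open>W\<close>, with maximum \<open>\<mu>\<close>, is an eigenvector. The form
  \<open>q y = \<mu> \<parallel>y\<parallel>\<^sup>2 - \<langle>y, T y\<rangle>\<close> is nonnegative on \<open>W\<close> and vanishes at \<open>x\<close>, so its derivative at \<open>x\<close>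
  vanishes on \<open>W\<close>. That derivative is represented by \<open>2 (\<mu> x - T x)\<close>, which lies in \<open>W\<close>.
\<close>

lemma selfadjoint_eigenvector_exists:
  fixes T :: "'a::euclidean_space \<Rightarrow> 'a"
  assumes T: "linear T" and sa: "\<And>x y. T x \<bullet> y = x \<bullet> T y"
    and W: "subspace W" "\<And>x. x \<in> W \<Longrightarrow> T x \<in> W" and w: "w \<in> W" "w \<noteq> 0"
  shows "\<exists>x\<in>W. norm x = 1 \<and> (\<exists>\<mu>. T x = \<mu> *\<^sub>R x)"
proof -
  let ?K = "sphere 0 1 \<inter> W"
  have "compact ?K"
    using W(1) by (intro compact_Int_closed compact_sphere closed_subspace)
  moreover have "w /\<^sub>R norm w \<in> ?K"
    using w W(1) by (simp add: subspace_scale)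
  then have "?K \<noteq> {}" by blast
  moreover have "continuous_on ?K (\<lambda>x. x \<bullet> T x)"
    using T by (intro continuous_intros linear_continuous_on) (simp add: linear_conv_bounded_linear)
  ultimately obtain x where x: "x \<in> ?K" and mx: "\<And>y. y \<in> ?K \<Longrightarrow> y \<bullet> T y \<le> x \<bullet> T x"
    using continuous_attains_sup[of ?K "\<lambda>x. x \<bullet> T x"] by blast
  define \<mu> where "\<mu> = x \<bullet> T x"
  have xx: "x \<bullet> x = 1" using x by (simp add: norm_eq_1)
  define q where "q y = \<mu> * (y \<bullet> y) - y \<bullet> T y" for y
  have q: "q y \<ge> 0" if "y \<in> W" for y
  proof (cases "y = 0")
    case False
    have "y /\<^sub>R norm y \<in> ?K"
      using that False W(1) by (simp add: subspace_scale)
    from mx[OF this] have "(y \<bullet> T y) / (norm y)\<^sup>2 \<le> \<mu>"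
      by (simp add: \<mu>_def linear_scale[OF T] power2_eq_square divide_inverse mult_ac)
    then show ?thesis using False
      by (simp add: q_def power2_norm_eq_inner[symmetric] pos_divide_le_eq)
  qed (simp add: q_def)
  define y where "y = \<mu> *\<^sub>R x - T x"
  have yW: "y \<in> W" unfolding y_def using x W by (auto intro: subspace_diff subspace_scale)
  have qt: "q (x + t *\<^sub>R y) = 2 * t * (y \<bullet> y) + t\<^sup>2 * q y" for t
  proof -
    have "q (x + t *\<^sub>R y) = q x + 2 * t * (\<mu> * (x \<bullet> y) - T x \<bullet> y) + t\<^sup>2 * q y"
      using sa[of x y] sa[of y x] unfolding q_def
      by (simp add: linear_add[OF T] linear_scale[OF T] inner_add_left inner_add_right
          inner_commute algebra_simps power2_eq_square)
    moreover have "q x = 0" by (simp add: q_def xx \<mu>_def)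
    moreover have "\<mu> * (x \<bullet> y) - T x \<bullet> y = y \<bullet> y"
      unfolding y_def by (simp add: inner_diff_left)
    ultimately show ?thesis by simp
  qed
  have "((\<lambda>t. q (x + t *\<^sub>R y)) has_real_derivative 2 * (y \<bullet> y)) (at 0)"
    unfolding qt by (auto intro!: derivative_eq_intros)
  moreover have "q (x + 0 *\<^sub>R y) \<le> q (x + t *\<^sub>R y)" for t
    using q[of "x + t *\<^sub>R y"] qt[of 0] x yW W(1) by (simp add: subspace_add subspace_scale)
  ultimately have "2 * (y \<bullet> y) = 0"
    by (intro DERIV_local_min[where d=1]) auto
  then have "T x = \<mu> *\<^sub>R x" by (simp add: y_def)
  then show ?thesis using x by auto
qed

text \<open>
  The spectral theorem. An orthonormal set of eigenvectors of largest cardinality spans the space: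
  its orthogonal complement is invariant, so it would otherwise contain one more eigenvector.
\<close>

theorem selfadjoint_orthonormal_eigenbasis:
  fixes T :: "'a::euclidean_space \<Rightarrow> 'a"
  assumes T: "linear T" and sa: "\<And>x y. T x \<bullet> y = x \<bullet> T y"
  shows "\<exists>E. orthonormal_basis E \<and> (\<forall>e\<in>E. \<exists>\<mu>. T e = \<mu> *\<^sub>R e)"
proof -
  define P where "P E \<longleftrightarrow> pairwise orthogonal E \<and> (\<forall>e\<in>E. norm e = 1) \<and> (\<forall>e\<in>E. \<exists>\<mu>. T e = \<mu> *\<^sub>R e)" for E
  have fin: "finite E" and cd: "card E < Suc DIM('a)" if "P E" for E
    using that orthonormal_set_independent[of E] independent_bound[of E] by (auto simp: P_def)
  have "P {}" by (simp add: P_def)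
  then obtain E where PE: "P E" and mx: "\<And>F. P F \<Longrightarrow> card F \<le> card E"
    using ex_has_greatest_nat[of P "{}" card "Suc DIM('a)"] cd by (metis less_imp_le)
  have "span E = UNIV"
  proof (rule ccontr)
    assume "span E \<noteq> UNIV"
    then obtain a where a: "a \<noteq> 0" "\<forall>x\<in>span E. a \<bullet> x = 0"
      using span_not_UNIV_orthogonal[of E] by blast
    let ?W = "{y. \<forall>e\<in>E. orthogonal e y}"
    have inv: "T y \<in> ?W" if y: "y \<in> ?W" for y
    proof -
      have "e \<bullet> T y = 0" if e: "e \<in> E" for e
      proof -
        obtain \<mu> where "T e = \<mu> *\<^sub>R e" using PE e by (auto simp: P_def)
        then have "e \<bullet> T y = \<mu> * (e \<bullet> y)" using sa[of e y] by simp
        then show ?thesis using y e by (simp add: orthogonal_def)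
      qed
      then show ?thesis by (simp add: orthogonal_def)
    qed
    have "a \<in> ?W" using a by (auto simp: orthogonal_def inner_commute span_base)
    with inv a obtain x where x: "x \<in> ?W" "norm x = 1" "\<exists>\<mu>. T x = \<mu> *\<^sub>R x"
      using selfadjoint_eigenvector_exists[OF T sa subspace_orthogonal_to_vectors[of E]] by blast
    have "x \<notin> E" using x by (auto simp: orthogonal_def)
    moreover have "P (insert x E)"
      using PE x by (auto simp: P_def pairwise_insert orthogonal_commute)
    ultimately show False using mx[of "insert x E"] fin[OF PE] by simp
  qed
  then show ?thesis using PE by (auto simp: P_def orthonormal_basis_def)
qed

section \<open>The trace inner product\<close>

lemma trace_transpose_mult_eq_inner:
  fixes A C :: "real^'m^'n"
  shows "trace (transpose A ** C) = A \<bullet> C"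
  unfolding trace_def matrix_matrix_mult_def transpose_def inner_vec_def
  by simp (rule sum.swap)

lemma matrix_inner_eq_sum_basis:
  fixes A C :: "real^'m^'n"
  assumes "orthonormal_basis E"
  shows "A \<bullet> C = (\<Sum>e\<in>E. (A *v e) \<bullet> (C *v e))"
proof -
  have "A \<bullet> C = (\<Sum>i\<in>UNIV. \<Sum>e\<in>E. (A $ i \<bullet> e) * (C $ i \<bullet> e))"
    unfolding inner_vec_def[of A C] by (simp add: parseval[OF assms, symmetric])
  also have "\<dots> = (\<Sum>e\<in>E. (A *v e) \<bullet> (C *v e))"
    unfolding inner_vec_def[where 'b='n and 'a=real] matrix_vector_mul_component inner_real_def
    by (rule sum.swap)
  finally show ?thesis .
qed

lemma matrix_transpose_inner:
  fixes A :: "real^'m^'n"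
  shows "(transpose A *v x) \<bullet> y = x \<bullet> (A *v y)"
  by (simp add: dot_lmul_matrix)

lemma trace_eq_inner_mat_1:
  fixes B :: "real^'p^'p"
  shows "trace B = mat 1 \<bullet> B"
  using trace_transpose_mult_eq_inner[of "mat 1" B] by simp

section \<open>Duality of the trace norm and the operator norm\<close>

lemma gram_orthonormal_eigenbasis_exists:
  fixes A :: "real^'m^'n"
  shows "\<exists>E. orthonormal_basis E \<and> (\<forall>e\<in>E. \<exists>\<mu>. (transpose A ** A) *v e = \<mu> *\<^sub>R e)"
proof (rule selfadjoint_orthonormal_eigenbasis)
  show "((transpose A ** A) *v x) \<bullet> y = x \<bullet> ((transpose A ** A) *v y)" for x y
    by (metis gram_inner inner_commute)
qed simp

text \<open>An eigenvalue of \<open>A\<^sup>T A\<close> at the unit vector \<open>e\<close> is the Rayleigh quotient \<open>\<langle>e, A\<^sup>T A e\<rangle> = \<parallel>A e\<parallel>\<^sup>2\<close>.\<close>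

lemma gram_eigenvalue:
  fixes A :: "real^'m^'n"
  assumes "(transpose A ** A) *v e = \<mu> *\<^sub>R e" "norm e = 1"
  shows "(transpose A ** A) *v e = (norm (A *v e))\<^sup>2 *\<^sub>R e"
proof -
  have "\<mu> * (e \<bullet> e) = (norm (A *v e))\<^sup>2"
    using gram_inner[of A e e] assms by (simp add: power2_norm_eq_inner)
  then show ?thesis using assms by (simp add: norm_eq_1)
qed

text \<open>
  A vector of the eigenspace for \<open>\<sigma>\<^sup>2\<close> is orthogonal to the basis vectors with another eigenvalue, so the
  eigenspace is spanned by the basis vectors with \<open>\<parallel>A e\<parallel> = \<sigma>\<close> and its dimension is their number.
\<close>

lemma sv_space_eq_span_eigenbasis:
  fixes A :: "real^'m^'n"
  assumes E: "orthonormal_basis E" and ev: "\<forall>e\<in>E. \<exists>\<mu>. (transpose A ** A) *v e = \<mu> *\<^sub>R e"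
    and \<sigma>: "\<sigma> \<ge> 0"
  shows "sv_space A \<sigma> = span {e\<in>E. norm (A *v e) = \<sigma>}"
proof
  have eig: "(transpose A ** A) *v e = (norm (A *v e))\<^sup>2 *\<^sub>R e" if "e \<in> E" for e
    using gram_eigenvalue that ev E by (metis orthonormal_basis_def)
  show "sv_space A \<sigma> \<subseteq> span {e\<in>E. norm (A *v e) = \<sigma>}"
  proof
    fix v assume "v \<in> sv_space A \<sigma>"
    then have v: "(transpose A ** A) *v v = \<sigma>\<^sup>2 *\<^sub>R v" by (simp add: sv_space_def)
    have "(v \<bullet> e) *\<^sub>R e \<in> span {e\<in>E. norm (A *v e) = \<sigma>}" if e: "e \<in> E" for e
    proof (cases "norm (A *v e) = \<sigma>")
      case False
      have "\<sigma>\<^sup>2 * (v \<bullet> e) = (norm (A *v e))\<^sup>2 * (v \<bullet> e)"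
        using gram_inner[of A v e] gram_inner[of A e v] v eig[OF e] by (simp add: inner_commute)
      then have "v \<bullet> e = 0" using False \<sigma> by (auto simp: power2_eq_iff_nonneg)
      then show ?thesis by (simp add: span_zero)
    qed (use e in \<open>auto intro: span_scale span_base\<close>)
    then have "(\<Sum>e\<in>E. (v \<bullet> e) *\<^sub>R e) \<in> span {e\<in>E. norm (A *v e) = \<sigma>}"
      by (rule span_sum)
    then show "v \<in> span {e\<in>E. norm (A *v e) = \<sigma>}"
      by (simp only: orthonormal_basis_expansion[OF E])
  qed
  have "subspace (sv_space A \<sigma>)"
    by (auto simp: subspace_def sv_space_def matrix_vector_right_distrib
        matrix_vector_mult_scaleR scaleR_add_right)
  then show "span {e\<in>E. norm (A *v e) = \<sigma>} \<subseteq> sv_space A \<sigma>"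
    by (intro span_minimal) (auto simp: sv_space_def eig)
qed

lemma trace_norm_eq_sum_eigenbasis:
  fixes A :: "real^'m^'n"
  assumes E: "orthonormal_basis E" and ev: "\<forall>e\<in>E. \<exists>\<mu>. (transpose A ** A) *v e = \<mu> *\<^sub>R e"
  shows "trace_norm A = (\<Sum>e\<in>E. norm (A *v e))"
proof -
  let ?F = "\<lambda>\<sigma>. {e\<in>E. norm (A *v e) = \<sigma>}"
  note sv = sv_space_eq_span_eigenbasis[OF E ev]
  have ne: "e \<noteq> 0" if "e \<in> E" for e
    using E that by (auto simp: orthonormal_basis_def)
  have dim: "dim (sv_space A \<sigma>) = card (?F \<sigma>)" if "\<sigma> \<ge> 0" for \<sigma>
  proof -
    have "independent (?F \<sigma>)"
      using E by (intro orthonormal_set_independent) (auto simp: orthonormal_basis_def pairwise_def)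
    then show ?thesis using sv[OF that] by (simp add: dim_eq_card_independent)
  qed
  have img: "singular_values A = (\<lambda>e. norm (A *v e)) ` E"
  proof
    show "singular_values A \<subseteq> (\<lambda>e. norm (A *v e)) ` E"
    proof
      fix \<sigma> assume "\<sigma> \<in> singular_values A"
      then obtain v where "\<sigma> \<ge> 0" "v \<noteq> 0" "v \<in> span (?F \<sigma>)"
        using sv by (auto simp: singular_values_def)
      then have "?F \<sigma> \<noteq> {}" by (metis span_empty singletonD)
      then show "\<sigma> \<in> (\<lambda>e. norm (A *v e)) ` E" by auto
    qed
    show "(\<lambda>e. norm (A *v e)) ` E \<subseteq> singular_values A"
      using sv[OF norm_ge_zero] ne by (force simp: singular_values_def intro: span_base)
  qed
  have "trace_norm A = (\<Sum>\<sigma>\<in>(\<lambda>e. norm (A *v e)) ` E. \<Sum>e\<in>?F \<sigma>. norm (A *v e))"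
    unfolding trace_norm_def img by (intro sum.cong refl) (auto simp: dim)
  also have "\<dots> = (\<Sum>e\<in>E. norm (A *v e))"
    by (rule sum.image_gen[symmetric]) (rule orthonormal_basis_finite[OF E])
  finally show ?thesis .
qed

lemma matrix_inner_le_onorm_trace_norm:
  fixes Q A :: "real^'m^'n"
  shows "\<bar>Q \<bullet> A\<bar> \<le> onorm ((*v) Q) * trace_norm A"
proof -
  obtain E where E: "orthonormal_basis E" "\<forall>e\<in>E. \<exists>\<mu>. (transpose A ** A) *v e = \<mu> *\<^sub>R e"
    using gram_orthonormal_eigenbasis_exists by blast
  have "\<bar>Q \<bullet> A\<bar> \<le> (\<Sum>e\<in>E. \<bar>(Q *v e) \<bullet> (A *v e)\<bar>)"
    unfolding matrix_inner_eq_sum_basis[OF E(1)] by (rule sum_abs)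
  also have "\<dots> \<le> (\<Sum>e\<in>E. onorm ((*v) Q) * norm (A *v e))"
  proof (rule sum_mono)
    fix e assume "e \<in> E"
    then have "norm e = 1" using E by (simp add: orthonormal_basis_def)
    then have "norm (Q *v e) \<le> onorm ((*v) Q)"
      using onorm[OF matrix_vector_mul_bounded_linear, of Q e] by simp
    then show "\<bar>(Q *v e) \<bullet> (A *v e)\<bar> \<le> onorm ((*v) Q) * norm (A *v e)"
      using Cauchy_Schwarz_ineq2[of "Q *v e" "A *v e"]
      by (meson mult_right_mono norm_ge_zero order_trans)
  qed
  also have "\<dots> = onorm ((*v) Q) * trace_norm A"
    by (simp add: trace_norm_eq_sum_eigenbasis[OF E] sum_distrib_left)
  finally show ?thesis .
qed

text \<open>
  The trace norm is attained in its dual description, by the partial isometry \<open>Q\<close> of the polar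
  decomposition of \<open>A\<close>. It sends an eigenvector \<open>e\<close> of \<open>A\<^sup>T A\<close> to \<open>A e / \<parallel>A e\<parallel>\<close>, or to \<open>0\<close> if \<open>A e = 0\<close>,
  and is a contraction because the vectors \<open>A e\<close> are mutually orthogonal.
\<close>

lemma trace_norm_attained:
  fixes A :: "real^'m^'n"
  shows "\<exists>Q :: real^'m^'n. (\<forall>x. norm (Q *v x) \<le> norm x) \<and> Q \<bullet> A = trace_norm A"
proof -
  obtain E where E: "orthonormal_basis E" and ev: "\<forall>e\<in>E. \<exists>\<mu>. (transpose A ** A) *v e = \<mu> *\<^sub>R e"
    using gram_orthonormal_eigenbasis_exists by blast
  have fin: "finite E" by (rule orthonormal_basis_finite[OF E])
  have orth: "e \<bullet> e' = (if e = e' then 1 else 0)" if "e \<in> E" "e' \<in> E" for e e'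
    using E that by (auto simp: orthonormal_basis_def pairwise_def orthogonal_def norm_eq_1)
  have Aorth: "(A *v e) \<bullet> (A *v e') = 0" if e: "e \<in> E" "e' \<in> E" "e \<noteq> e'" for e e'
  proof -
    obtain \<mu> where \<mu>: "(transpose A ** A) *v e = \<mu> *\<^sub>R e" using ev e(1) by blast
    have "(A *v e) \<bullet> (A *v e') = \<mu> * (e \<bullet> e')"
      by (simp only: gram_inner[symmetric] \<mu> inner_scaleR_left)
    then show ?thesis using orth[OF e(1,2)] e(3) by simp
  qed
  define q where "q x = (\<Sum>e\<in>E. (x \<bullet> e) *\<^sub>R sgn (A *v e))" for x
  have "linear q"
    unfolding q_def
    by (rule linearI) (simp_all add: inner_add_left scaleR_add_left sum.distrib scaleR_sum_right)
  then have Q: "matrix q *v x = q x" for x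
    by (simp add: matrix_works linear_matrix_vector_mul_eq)
  have qe: "q e = sgn (A *v e)" if "e \<in> E" for e
  proof -
    have "q e = (\<Sum>e'\<in>E. if e' = e then sgn (A *v e') else 0)"
      unfolding q_def using that orth by (intro sum.cong) auto
    then show ?thesis using that fin by simp
  qed
  have "norm (q x) \<le> norm x" for x
  proof -
    have "(norm (q x))\<^sup>2 = (\<Sum>e\<in>E. (norm ((x \<bullet> e) *\<^sub>R sgn (A *v e)))\<^sup>2)"
      unfolding q_def using fin Aorth
      by (intro norm_sum_Pythagorean) (auto simp: pairwise_def orthogonal_def sgn_div_norm)
    also have "\<dots> \<le> (\<Sum>e\<in>E. (x \<bullet> e) * (x \<bullet> e))"
      by (intro sum_mono) (auto simp: norm_sgn power2_eq_square)
    also have "\<dots> = (norm x)\<^sup>2"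
      by (simp only: parseval[OF E, symmetric] power2_norm_eq_inner)
    finally show ?thesis by (rule power2_le_imp_le) simp
  qed
  moreover have "matrix q \<bullet> A = trace_norm A"
  proof -
    have "sgn (A *v e) \<bullet> (A *v e) = norm (A *v e)" for e
      by (cases "A *v e = 0")
        (simp_all add: sgn_div_norm power2_norm_eq_inner[symmetric] power2_eq_square)
    then show ?thesis
      unfolding matrix_inner_eq_sum_basis[OF E] trace_norm_eq_sum_eigenbasis[OF E ev]
      by (intro sum.cong) (auto simp: Q qe)
  qed
  ultimately show ?thesis using Q by (intro exI[of _ "matrix q"]) simp
qed

lemma contraction_inner_le_trace_norm:
  fixes Q A :: "real^'m^'n"
  assumes "\<And>x. norm (Q *v x) \<le> norm x"
  shows "Q \<bullet> A \<le> trace_norm A"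
proof -
  have "onorm ((*v) Q) \<le> 1" using assms by (intro onorm_le) simp
  moreover have "0 \<le> trace_norm A"
    unfolding trace_norm_def by (intro sum_nonneg) (auto simp: singular_values_def)
  ultimately have "onorm ((*v) Q) * trace_norm A \<le> 1 * trace_norm A"
    by (intro mult_right_mono)
  then show ?thesis using matrix_inner_le_onorm_trace_norm[of Q A] by linarith
qed

section \<open>Two bounds on the trace norm\<close>

definition outer :: "real^'n \<Rightarrow> real^'m \<Rightarrow> real^'m^'n" where
  "outer u v = (\<chi> i j. u $ i * v $ j)"

lemma inner_outer: "Q \<bullet> outer u v = (Q *v v) \<bullet> u"
  by (simp add: outer_def inner_vec_def matrix_vector_mult_def sum_distrib_left sum_distrib_right mult_ac)

lemma trace_norm_add_outer_le:
  assumes "t \<ge> 0"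
  shows "trace_norm (A + t *\<^sub>R outer u v) \<le> trace_norm A + t * (norm u * norm v)"
proof -
  obtain Q where Q: "\<And>x. norm (Q *v x) \<le> norm x"
    and eq: "Q \<bullet> (A + t *\<^sub>R outer u v) = trace_norm (A + t *\<^sub>R outer u v)"
    using trace_norm_attained by blast
  have "(Q *v v) \<bullet> u \<le> norm (Q *v v) * norm u" by (rule norm_cauchy_schwarz)
  also have "\<dots> \<le> norm v * norm u" using Q by (simp add: mult_right_mono)
  finally have "t * ((Q *v v) \<bullet> u) \<le> t * (norm u * norm v)"
    using assms by (simp add: mult_left_mono mult.commute)
  then show ?thesis
    using eq contraction_inner_le_trace_norm[OF Q, of A]
    by (simp add: inner_add_right inner_outer)
qed

lemma stiefel_norm:
  assumes "U \<in> stiefel"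
  shows "norm (U *v x) = norm x"
  using gram_inner[of U x x] assms by (simp add: stiefel_def norm_eq_sqrt_inner)

text \<open>
  Testing against a contraction \<open>Q\<close> and expanding in an orthonormal eigenbasis of \<open>B\<close> gives
  \<open>\<langle>Q, U B V\<^sup>T\<rangle> = (\<Sum>e. \<beta>\<^sub>e \<langle>Q V e, U e\<rangle>)\<close>, where each eigenvalue \<open>\<beta>\<^sub>e\<close> is positive and multiplies a
  number that is at most \<open>1\<close>.
\<close>

lemma trace_norm_factorization_le:
  fixes U :: "real^'p^'n" and B :: "real^'p^'p" and V :: "real^'p^'m"
  assumes U: "U \<in> stiefel" and B: "B \<in> spd_cone" and V: "V \<in> stiefel"
  shows "trace_norm (U ** B ** transpose V) \<le> trace B"
proof -
  let ?X = "U ** B ** transpose V"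
  obtain Q where Q: "\<And>x. norm (Q *v x) \<le> norm x" and eq: "Q \<bullet> ?X = trace_norm ?X"
    using trace_norm_attained by blast
  have Bt: "transpose B = B" and pos: "\<And>v. v \<noteq> 0 \<Longrightarrow> 0 < v \<bullet> (B *v v)"
    using B by (auto simp: spd_cone_def)
  have "(B *v x) \<bullet> y = x \<bullet> (B *v y)" for x y
    using matrix_transpose_inner[of B x y] Bt by simp
  then obtain E where E: "orthonormal_basis E" and ev: "\<forall>e\<in>E. \<exists>\<mu>. B *v e = \<mu> *\<^sub>R e"
    using selfadjoint_orthonormal_eigenbasis[of "(*v) B"] by auto
  have "Q \<bullet> ?X = trace (transpose Q ** (U ** B ** transpose V))"
    by (simp add: trace_transpose_mult_eq_inner)
  also have "\<dots> = trace (transpose Q ** U ** B ** transpose V)"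
    by (simp add: matrix_mul_assoc)
  also have "\<dots> = trace (transpose V ** (transpose Q ** U ** B))"
    by (rule trace_mul_sym)
  also have "\<dots> = trace (transpose (transpose U ** Q ** V) ** B)"
    by (simp add: matrix_transpose_mul matrix_mul_assoc)
  also have "\<dots> = (\<Sum>e\<in>E. ((transpose U ** Q ** V) *v e) \<bullet> (B *v e))"
    unfolding trace_transpose_mult_eq_inner by (rule matrix_inner_eq_sum_basis[OF E])
  also have "\<dots> \<le> (\<Sum>e\<in>E. e \<bullet> (B *v e))"
  proof (rule sum_mono)
    fix e assume e: "e \<in> E"
    then obtain \<mu> where \<mu>: "B *v e = \<mu> *\<^sub>R e" using ev by blast
    have e1: "norm e = 1" using E e by (simp add: orthonormal_basis_def)
    then have "\<mu> \<ge> 0" using pos[of e] \<mu> by (force simp: norm_eq_1)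
    have "((transpose U ** Q ** V) *v e) \<bullet> e = (Q *v (V *v e)) \<bullet> (U *v e)"
      by (simp add: matrix_vector_mul_assoc[symmetric] dot_lmul_matrix)
    also have "\<dots> \<le> norm (Q *v (V *v e)) * norm (U *v e)" by (rule norm_cauchy_schwarz)
    also have "\<dots> \<le> 1" using Q[of "V *v e"] U V e1 by (simp add: stiefel_norm)
    finally have "\<mu> * (((transpose U ** Q ** V) *v e) \<bullet> e) \<le> \<mu> * 1"
      using \<open>\<mu> \<ge> 0\<close> by (rule mult_left_mono)
    then show "((transpose U ** Q ** V) *v e) \<bullet> (B *v e) \<le> e \<bullet> (B *v e)"
      using \<mu> e1 by (simp add: norm_eq_1)
  qed
  also have "\<dots> = mat 1 \<bullet> B" by (simp add: matrix_inner_eq_sum_basis[OF E])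
  also have "\<dots> = trace B" by (rule trace_eq_inner_mat_1[symmetric])
  finally show ?thesis using eq by simp
qed

lemma spd_trace_pos:
  assumes "B \<in> spd_cone"
  shows "trace B > 0"
proof -
  have "B $ i $ i > 0" for i
  proof -
    have "0 < axis i 1 \<bullet> (B *v axis i 1)"
      using assms by (simp add: spd_cone_def axis_eq_0_iff)
    then show ?thesis
      by (simp add: inner_axis' matrix_vector_mul_component inner_axis)
  qed
  then show ?thesis unfolding trace_def by (intro sum_pos) auto
qed

section \<open>First-order conditions\<close>

lemma gradient_directional_derivative:
  assumes "is_gradient f X S"
  shows "((\<lambda>t. f (X + t *\<^sub>R W)) has_real_derivative S \<bullet> W) (at 0)"
proof -
  have "(f has_derivative (\<lambda>H. S \<bullet> H)) (at (X + 0 *\<^sub>R W))"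
    using assms by (simp add: is_gradient_def trace_transpose_mult_eq_inner)
  then have "((\<lambda>t. f (X + t *\<^sub>R W)) has_derivative (\<lambda>t. S \<bullet> (t *\<^sub>R W))) (at 0)"
    by (rule has_derivative_compose[rotated]) (auto intro!: derivative_eq_intros)
  moreover have "(\<lambda>t. S \<bullet> (t *\<^sub>R W)) = (*) (S \<bullet> W)"
    by (simp add: fun_eq_iff)
  ultimately show ?thesis by (simp add: has_field_derivative_def)
qed

lemma convex_gradient_inequality:
  fixes f :: "real^'m^'n \<Rightarrow> real"
  assumes cv: "convex_on UNIV f" and S: "is_gradient f X S"
  shows "f Y \<ge> f X + S \<bullet> (Y - X)"
proof -
  define g where "g t = f (X + t *\<^sub>R (Y - X))" for t :: real
  have "convex_on UNIV g"
  proof (rule convex_onI)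
    fix t x y :: real assume t: "0 < t" "t < 1"
    have "X + ((1 - t) *\<^sub>R x + t *\<^sub>R y) *\<^sub>R (Y - X)
        = (1 - t) *\<^sub>R (X + x *\<^sub>R (Y - X)) + t *\<^sub>R (X + y *\<^sub>R (Y - X))"
      by (simp add: algebra_simps)
    then show "g ((1 - t) *\<^sub>R x + t *\<^sub>R y) \<le> (1 - t) * g x + t * g y"
      unfolding g_def using convex_onD[OF cv, of t] t by simp
  qed simp
  moreover have "(g has_real_derivative S \<bullet> (Y - X)) (at 0)"
    unfolding g_def by (rule gradient_directional_derivative[OF S])
  ultimately have "g 1 - g 0 \<ge> (S \<bullet> (Y - X)) * (1 - 0)"
    using convex_on_imp_above_tangent[of UNIV g 0 1] by simp
  then show ?thesis by (simp add: g_def)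
qed

text \<open>Scaling \<open>B\<close> is a feasible variation, and it moves \<open>X\<close> along the ray through \<open>X\<close>.\<close>

lemma local_min_scaling_condition:
  fixes f :: "real^'m^'n \<Rightarrow> real"
    and U :: "real^'p^'n" and B :: "real^'p^'p" and V :: "real^'p^'m"
  assumes lm: "is_local_min (\<lambda>(U, B, V). f (U ** B ** transpose V) + lam * trace B)
           (stiefel \<times> spd_cone \<times> stiefel) (U, B, V)"
    and S: "is_gradient f (U ** B ** transpose V) S"
  shows "S \<bullet> (U ** B ** transpose V) = - lam * trace B"
proof -
  let ?X = "U ** B ** transpose V"
  obtain \<epsilon> where \<epsilon>: "\<epsilon> > 0" and feas: "U \<in> stiefel" "B \<in> spd_cone" "V \<in> stiefel"
    and mn: "\<And>U' B' V'. \<lbrakk>U' \<in> stiefel; B' \<in> spd_cone; V' \<in> stiefel; dist (U', B', V') (U, B, V) < \<epsilon>\<rbrakk>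
      \<Longrightarrow> f ?X + lam * trace B \<le> f (U' ** B' ** transpose V') + lam * trace B'"
    using lm by (auto simp: is_local_min_def)
  define g where "g t = f (?X + t *\<^sub>R ?X) + lam * ((1 + t) * trace B)" for t :: real
  have "(g has_real_derivative S \<bullet> ?X + lam * trace B) (at 0)"
    unfolding g_def
    by (auto intro!: derivative_eq_intros gradient_directional_derivative[OF S])
  moreover define d where "d = min 1 (\<epsilon> / (norm B + 1))"
  have "d > 0" using \<epsilon> by (simp add: d_def add_nonneg_pos)
  moreover have "g 0 \<le> g t" if t: "\<bar>0 - t\<bar> < d" for t
  proof -
    have t1: "1 + t > 0" using t by (auto simp: d_def)
    have "(1 + t) *\<^sub>R B \<in> spd_cone"
      using feas(2) t1
      by (auto simp: spd_cone_def transpose_scalar scaleR_matrix_vector_assoc[symmetric])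
    moreover have "dist (U, (1 + t) *\<^sub>R B, V) (U, B, V) < \<epsilon>"
    proof -
      have "dist (U, (1 + t) *\<^sub>R B, V) (U, B, V) = \<bar>t\<bar> * norm B"
        by (simp add: dist_Pair_Pair dist_norm scaleR_add_left)
      also have "\<dots> \<le> \<bar>t\<bar> * (norm B + 1)" by (simp add: mult_left_mono)
      also have "\<dots> < \<epsilon>"
        using t by (simp add: d_def pos_less_divide_eq add_nonneg_pos)
      finally show ?thesis .
    qed
    ultimately have "f ?X + lam * trace B
        \<le> f (U ** ((1 + t) *\<^sub>R B) ** transpose V) + lam * trace ((1 + t) *\<^sub>R B)"
      using mn feas by blast
    moreover have "U ** ((1 + t) *\<^sub>R B) ** transpose V = ?X + t *\<^sub>R ?X"
      by (simp add: vec_eq_iff matrix_matrix_mult_def sum_distrib_left sum_distrib_right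
          sum.distrib algebra_simps)
    moreover have "trace ((1 + t) *\<^sub>R B) = (1 + t) * trace B"
      by (simp add: trace_def sum_distrib_left)
    ultimately show ?thesis by (simp add: g_def)
  qed
  ultimately have "S \<bullet> ?X + lam * trace B = 0"
    by (intro DERIV_local_min[of g _ 0 d]) auto
  then show ?thesis by simp
qed

text \<open>
  Moving from a global minimiser in the direction \<open>- u v\<^sup>T\<close> with \<open>u = S v\<close> changes \<open>f\<close> to first order by
  \<open>- t \<parallel>S v\<parallel>\<^sup>2\<close> and the trace norm by at most \<open>t \<parallel>S v\<parallel> \<parallel>v\<parallel>\<close>.
\<close>

lemma global_min_onorm_gradient_le:
  fixes f :: "real^'m^'n \<Rightarrow> real"
  assumes gm: "is_global_min (\<lambda>Y. f Y + lam * trace_norm Y) X"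
    and S: "is_gradient f X S" and lam: "lam \<ge> 0"
  shows "onorm ((*v) S) \<le> lam"
proof (rule onorm_le)
  fix v :: "real^'m"
  let ?c = "norm (S *v v) * norm v"
  let ?W = "outer (- (S *v v)) v"
  define g where "g t = f (X + t *\<^sub>R ?W) + lam * (t * ?c)" for t :: real
  have "(g has_real_derivative S \<bullet> ?W + lam * ?c) (at 0)"
    unfolding g_def
    by (auto intro!: derivative_eq_intros gradient_directional_derivative[OF S])
  moreover have "\<not> g t < g 0" if "t > 0" for t
  proof -
    have "lam * trace_norm (X + t *\<^sub>R ?W) \<le> lam * (trace_norm X + t * ?c)"
      using trace_norm_add_outer_le[of t X "- (S *v v)" v] that lam by (intro mult_left_mono) auto
    moreover have "f X + lam * trace_norm X
        \<le> f (X + t *\<^sub>R ?W) + lam * trace_norm (X + t *\<^sub>R ?W)"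
      using gm by (simp add: is_global_min_def)
    ultimately show ?thesis by (simp add: g_def distrib_left)
  qed
  ultimately have "\<not> S \<bullet> ?W + lam * ?c < 0"
    using DERIV_neg_dec_right[of g _ 0] by (metis add_0 dense)
  then have "norm (S *v v) * norm (S *v v) \<le> norm (S *v v) * (lam * norm v)"
    by (simp add: inner_outer power2_norm_eq_inner[symmetric] power2_eq_square mult_ac)
  then show "norm (S *v v) \<le> lam * norm v"
    using lam by (cases "S *v v = 0") (auto simp: mult_le_cancel_left)
qed

section \<open>Optimality certificate for fixed-rank local minima\<close>

theorem proposition2p2:
  fixes f :: "real^'m^'n \<Rightarrow> real" and lam :: real
    and U :: "real^'p^'n" and B :: "real^'p^'p" and V :: "real^'p^'m"
    and X S :: "real^'m^'n"
  assumes "smooth f" and "convex_on UNIV f"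
    and "lam > 0"
    and "1 \<le> CARD('p)" and "CARD('p) \<le> min CARD('n) CARD('m)"
    and "is_local_min (\<lambda>(U, B, V). f (U ** B ** transpose V) + lam * trace B)
           (stiefel \<times> spd_cone \<times> stiefel) (U, B, V)"
    and "X = U ** B ** transpose V"
    and "is_gradient f (U ** B ** transpose V) S"
  shows "(is_global_min (\<lambda>Y. f Y + lam * trace_norm Y) X \<longleftrightarrow> onorm ((*v) S) = lam)
    \<and> onorm ((*v) S) \<ge> lam
    \<and> (onorm ((*v) S) = lam \<longrightarrow> is_global_min (\<lambda>Y. f Y + lam * trace_norm Y) X)"
proof -
  have feas: "U \<in> stiefel" "B \<in> spd_cone" "V \<in> stiefel"
    using assms(6) by (auto simp: is_local_min_def)
  have S: "is_gradient f X S" using assms(7,8) by simp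
  have SX: "S \<bullet> X = - lam * trace B"
    using local_min_scaling_condition[OF assms(6,8)] assms(7) by simp
  have XB: "trace_norm X \<le> trace B"
    using trace_norm_factorization_le[OF feas] assms(7) by simp
  have Bpos: "trace B > 0" by (rule spd_trace_pos[OF feas(2)])
  have ge: "lam \<le> onorm ((*v) S)"
  proof -
    have "lam * trace B \<le> \<bar>S \<bullet> X\<bar>" using SX by simp
    also have "\<dots> \<le> onorm ((*v) S) * trace_norm X" by (rule matrix_inner_le_onorm_trace_norm)
    also have "\<dots> \<le> onorm ((*v) S) * trace B"
      using XB by (intro mult_left_mono onorm_pos_le matrix_vector_mul_bounded_linear)
    finally show ?thesis using Bpos by simp
  qed
  have opt: "is_global_min (\<lambda>Y. f Y + lam * trace_norm Y) X" if eq: "onorm ((*v) S) = lam"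
    unfolding is_global_min_def
  proof
    fix Y
    have "f X + S \<bullet> Y - S \<bullet> X \<le> f Y"
      using convex_gradient_inequality[OF assms(2) S, of Y] by (simp add: inner_diff_right)
    moreover have "- (lam * trace_norm Y) \<le> S \<bullet> Y"
      using matrix_inner_le_onorm_trace_norm[of S Y] eq by simp
    moreover have "lam * trace_norm X \<le> lam * trace B"
      using XB assms(3) by (simp add: mult_left_mono)
    ultimately show "f X + lam * trace_norm X \<le> f Y + lam * trace_norm Y"
      using SX by simp
  qed
  have "onorm ((*v) S) \<le> lam" if "is_global_min (\<lambda>Y. f Y + lam * trace_norm Y) X"
    using global_min_onorm_gradient_le[OF that S] assms(3) by simp
  with ge opt show ?thesis by (meson order_antisym)
qed

end
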